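(* Let $k$ be an algebraically closed field, let $r\ge 3$, and let $M\in\mathrm{rep}(C_r)$ be an indecomposable representation. The following statements are equivalent: (a) $N:=\pi_\lambda(M)$ has the equal kernels property, i.e. $\sum_{i=1}^r\alpha_iN(\gamma_i)\colon N_1\to N_2$ is injective for all $\alpha\in k^r\setminus\{0\}$. (b) $N(\gamma_i)$ is injective for all $i\in\{1,\dots,r\}$. (c) $M\in\mathrm{Inj}$, i.e. $M(\delta)$ is injective for every arrow $\delta$ of $C_r$.
   Context: $k$ has arbitrary characteristic. $\Gamma_r$ is the quiver with two vertices $1,2$ and $r$ arrows $\gamma_1,\dots,\gamma_r\colon 1\to 2$; $\mathrm{rep}(\Gamma_r)$ is the category of its finite-dimensional representations over $k$. Universal cover. Consider walks in $\Gamma_r$ (formal composable sequences of arrows and formal inverses of arrows, written right to left, including the trivial walks $\epsilon_1,\epsilon_2$) modulo the equivalence relation generated by $\gamma_i^{-1}\gamma_i\sim\epsilon_1$, $\gamma_i\gamma_i^{-1}\sim\epsilon_2$. The quiver $C_r$ has as vertices the classes $[w]$ of walks $w$ starting in $1$, and an arrow $[w]\to[\gamma_iw]$ for each $i$ and each $[w]$ with $t(w)=1$, where $t(w)$ is the end vertex of $w$. Its underlying graph is an $r$-regular tree and each vertex is a source or a sink. The quiver morphism $\pi\colon C_r\to\Gamma_r$ is given by $[w]\mapsto t(w)$, $([w]\to[\gamma_iw])\mapsto\gamma_i$. $\mathrm{rep}(C_r)$ is the category of representations of $C_r$ of finite total dimension. The push-down functor $\pi_\lambda\colon\mathrm{rep}(C_r)\to\mathrm{rep}(\Gamma_r)$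 is given by $\pi_\lambda(M)_i=\bigoplus_{\pi(y)=i}M_y$ for $i\in\{1,2\}$ and $\pi_\lambda(M)(\gamma_i)=\bigoplus_{\pi(\beta)=\gamma_i}M(\beta)$ for $1\le i\le r$, and analogously on morphisms. *)

theory Defs
  imports
    "HOL-Computational_Algebra.Computational_Algebra"
    "HOL-Library.Function_Algebras"
    "Graph_Theory.Digraph"
begin

section \<open>Quiver representations\<close>

text \<open>
  A quiver is a directed multigraph, i.e. a \<^typ>\<open>('a, 'b) pre_digraph\<close> satisfying
  \<^const>\<open>wf_digraph\<close>.  The spaces of one representation are subspaces of a common ambient
  vector space (the type \<open>'v\<close> with scalar multiplication \<open>scl\<close>).  This is no restriction: any
  family of vector spaces embeds into its direct sum.  Only the values of \<open>sp\<close> on vertices, and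
  of \<open>mp b\<close> on the space at the tail of \<open>b\<close>, are meaningful.
\<close>

record ('a, 'b, 'k, 'v) quiver_rep =
  scl :: "'k \<Rightarrow> 'v \<Rightarrow> 'v"
  sp :: "'a \<Rightarrow> 'v set"
  mp :: "'b \<Rightarrow> 'v \<Rightarrow> 'v"

definition linear_betw ::
    "('k::field \<Rightarrow> 'v::ab_group_add \<Rightarrow> 'v) \<Rightarrow> 'v set \<Rightarrow> 'v set \<Rightarrow> ('v \<Rightarrow> 'v) \<Rightarrow> bool" where
  "linear_betw s U W f \<longleftrightarrow> f \<in> U \<rightarrow> W \<and>
     (\<forall>u\<in>U. \<forall>u'\<in>U. f (u + u') = f u + f u') \<and> (\<forall>c. \<forall>u\<in>U. f (s c u) = s c (f u))"

definition fin_dim :: "('k::field \<Rightarrow> 'v::ab_group_add \<Rightarrow> 'v) \<Rightarrow> 'v set \<Rightarrow> bool" where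
  "fin_dim s U \<longleftrightarrow> (\<exists>B. finite B \<and> module.span s B = U)"

text \<open>Representations of finite total dimension.\<close>

definition rep ::
    "('a, 'b) pre_digraph \<Rightarrow> ('a, 'b, 'k::field, 'v::ab_group_add) quiver_rep set" where
  "rep Q = {M. vector_space (scl M) \<and>
     (\<forall>y\<in>verts Q. module.subspace (scl M) (sp M y) \<and> fin_dim (scl M) (sp M y)) \<and>
     finite {y \<in> verts Q. sp M y \<noteq> {0}} \<and>
     (\<forall>b\<in>arcs Q. linear_betw (scl M) (sp M (tail Q b)) (sp M (head Q b)) (mp M b))}"

definition subrep ::
    "('a, 'b) pre_digraph \<Rightarrow> ('a, 'b, 'k::field, 'v::ab_group_add) quiver_rep
     \<Rightarrow> ('a \<Rightarrow> 'v set) \<Rightarrow> bool" where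
  "subrep Q M U \<longleftrightarrow> (\<forall>y\<in>verts Q. module.subspace (scl M) (U y) \<and> U y \<subseteq> sp M y) \<and>
     (\<forall>b\<in>arcs Q. mp M b ` U (tail Q b) \<subseteq> U (head Q b))"

definition indecomposable ::
    "('a, 'b) pre_digraph \<Rightarrow> ('a, 'b, 'k::field, 'v::ab_group_add) quiver_rep \<Rightarrow> bool" where
  "indecomposable Q M \<longleftrightarrow> (\<exists>y\<in>verts Q. sp M y \<noteq> {0}) \<and>
     (\<forall>U W. subrep Q M U \<and> subrep Q M W \<and>
        (\<forall>y\<in>verts Q. sp M y = {u + w |u w. u \<in> U y \<and> w \<in> W y} \<and> U y \<inter> W y = {0})
        \<longrightarrow> (\<forall>y\<in>verts Q. U y = {0}) \<or> (\<forall>y\<in>verts Q. W y = {0}))"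

definition Inj ::
    "('a, 'b) pre_digraph \<Rightarrow> ('a, 'b, 'k::field, 'v::ab_group_add) quiver_rep set" where
  "Inj Q = {M \<in> rep Q. \<forall>b\<in>arcs Q. inj_on (mp M b) (sp M (tail Q b))}"


section \<open>Walks and the universal cover\<close>

datatype 'b letter = Arr 'b | Inv 'b

text \<open>
  Words are written right to left: in \<open>Arr b # w\<close> the word \<open>w\<close> is walked first.
  \<open>walk Q x w y\<close> says that \<open>w\<close> is a walk starting in \<open>x\<close> and ending in \<open>y\<close>; together
  with the start vertex \<open>x\<close>, the empty word is the trivial walk at \<open>x\<close>.
\<close>

inductive walk :: "('a, 'b) pre_digraph \<Rightarrow> 'a \<Rightarrow> 'b letter list \<Rightarrow> 'a \<Rightarrow> bool"
  for Q :: "('a, 'b) pre_digraph" and x :: 'a where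
  trivial: "x \<in> verts Q \<Longrightarrow> walk Q x [] x"
| Arr: "walk Q x w (tail Q b) \<Longrightarrow> b \<in> arcs Q \<Longrightarrow> walk Q x (Arr b # w) (head Q b)"
| Inv: "walk Q x w (head Q b) \<Longrightarrow> b \<in> arcs Q \<Longrightarrow> walk Q x (Inv b # w) (tail Q b)"

inductive walk_equiv ::
    "('a, 'b) pre_digraph \<Rightarrow> 'a \<Rightarrow> 'b letter list \<Rightarrow> 'b letter list \<Rightarrow> bool"
  for Q :: "('a, 'b) pre_digraph" and x :: 'a where
  refl: "walk Q x w y \<Longrightarrow> walk_equiv Q x w w"
| sym: "walk_equiv Q x w w' \<Longrightarrow> walk_equiv Q x w' w"
| trans: "walk_equiv Q x w w' \<Longrightarrow> walk_equiv Q x w' w'' \<Longrightarrow> walk_equiv Q x w w''"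
| cancel_tail: "walk Q x (u @ [Inv b, Arr b] @ v) y
    \<Longrightarrow> walk_equiv Q x (u @ [Inv b, Arr b] @ v) (u @ v)"
| cancel_head: "walk Q x (u @ [Arr b, Inv b] @ v) y
    \<Longrightarrow> walk_equiv Q x (u @ [Arr b, Inv b] @ v) (u @ v)"

definition walk_rel :: "('a, 'b) pre_digraph \<Rightarrow> 'a \<Rightarrow> ('b letter list \<times> 'b letter list) set" where
  "walk_rel Q x = {(w, w'). walk_equiv Q x w w'}"

text \<open>The common end vertex of the walks starting in \<open>x\<close> that belong to the class \<open>c\<close>.\<close>

definition end_vertex :: "('a, 'b) pre_digraph \<Rightarrow> 'a \<Rightarrow> 'b letter list set \<Rightarrow> 'a" where
  "end_vertex Q x c = (THE y. \<exists>w\<in>c. walk Q x w y)"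

text \<open>
  The arrow from the class of \<open>w\<close> to the class of \<open>Arr b # w\<close> is encoded as the pair of the class
  of \<open>w\<close> and \<open>b\<close>.  Its head does not depend on the representative \<open>w\<close>, so the union below is that
  single class; see \<open>head_universal_cover\<close>.
\<close>

definition universal_cover :: "('a, 'b) pre_digraph \<Rightarrow> 'a
    \<Rightarrow> ('b letter list set, 'b letter list set \<times> 'b) pre_digraph" where
  "universal_cover Q x =
    \<lparr> verts = {w. \<exists>y. walk Q x w y} // walk_rel Q x,
      arcs = {(c, b). c \<in> {w. \<exists>y. walk Q x w y} // walk_rel Q x \<and>
                      b \<in> arcs Q \<and> end_vertex Q x c = tail Q b},
      tail = fst,
      head = (\<lambda>(c, b). \<Union>w\<in>c. walk_rel Q x `` {Arr b # w}) \<rparr>"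


section \<open>The push-down functor on objects\<close>

text \<open>
  \<open>C\<close> is the covering quiver, with projection \<open>pv\<close> on vertices and \<open>pa\<close> on arrows.  An element of
  the direct sum of the \<open>sp M y\<close> over the fibre of \<open>i\<close> is a finitely supported function on the
  vertices of \<open>C\<close> vanishing outside that fibre.  In the map at \<open>g\<close>, the sum runs over the arrows
  above \<open>g\<close> ending in \<open>z\<close>; a covering has at most one of them.
\<close>

definition push_down :: "('c, 'd) pre_digraph \<Rightarrow> ('c \<Rightarrow> 'a) \<Rightarrow> ('d \<Rightarrow> 'b)
    \<Rightarrow> ('c, 'd, 'k::field, 'v::ab_group_add) quiver_rep \<Rightarrow> ('a, 'b, 'k, 'c \<Rightarrow> 'v) quiver_rep" where
  "push_down C pv pa M =
    \<lparr> scl = (\<lambda>a f y. scl M a (f y)),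
      sp = (\<lambda>i. {f. finite {y. f y \<noteq> 0} \<and>
                    (\<forall>y. if y \<in> verts C \<and> pv y = i then f y \<in> sp M y else f y = 0)}),
      mp = (\<lambda>g f z. \<Sum>d | d \<in> arcs C \<and> pa d = g \<and> head C d = z. mp M d (f (tail C d))) \<rparr>"


section \<open>Kronecker quivers\<close>

definition Kronecker_quiver :: "nat \<Rightarrow> (nat, nat) pre_digraph" (\<open>\<Gamma>\<close>) where
  "\<Gamma> r = \<lparr> verts = {1, 2}, arcs = {1..r}, tail = (\<lambda>_. 1), head = (\<lambda>_. 2) \<rparr>"

definition Kronecker_cover ::
    "nat \<Rightarrow> (nat letter list set, nat letter list set \<times> nat) pre_digraph" (\<open>\<C>\<close>) where
  "\<C> r = universal_cover (\<Gamma> r) 1"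

definition push_down_Kronecker :: "nat
    \<Rightarrow> (nat letter list set, nat letter list set \<times> nat, 'k::field, 'v::ab_group_add) quiver_rep
    \<Rightarrow> (nat, nat, 'k, nat letter list set \<Rightarrow> 'v) quiver_rep" (\<open>\<pi>\<^sub>\<lambda>\<close>) where
  "\<pi>\<^sub>\<lambda> r M = push_down (\<C> r) (end_vertex (\<Gamma> r) 1) snd M"

definition equal_kernels ::
    "nat \<Rightarrow> (nat, nat, 'k::field, 'v::ab_group_add) quiver_rep \<Rightarrow> bool" where
  "equal_kernels r N \<longleftrightarrow> (\<forall>\<alpha> :: nat \<Rightarrow> 'k. (\<exists>i\<in>{1..r}. \<alpha> i \<noteq> 0) \<longrightarrow>
     inj_on (\<lambda>x. \<Sum>i\<in>{1..r}. scl N (\<alpha> i) (mp N i x)) (sp N 1))"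


section \<open>Well-definedness\<close>

inductive_cases walk_NilE: "walk Q x [] y"
inductive_cases walk_ArrE: "walk Q x (Arr b # w) y"
inductive_cases walk_InvE: "walk Q x (Inv b # w) y"

lemma walk_end_unique: "walk Q x w y \<Longrightarrow> walk Q x w y' \<Longrightarrow> y = y'"
  by (induction arbitrary: y' rule: walk.induct) (blast elim: walk_NilE walk_ArrE walk_InvE)+

lemma walk_suffix: "walk Q x (u @ v) y \<Longrightarrow> \<exists>z. walk Q x v z"
proof (induction u arbitrary: y)
  case (Cons l u)
  then show ?case by (cases l) (auto elim!: walk_ArrE walk_InvE)
qed auto

lemma walk_replace_suffix:
  assumes "walk Q x (u @ v) y" "walk Q x v z" "walk Q x v' z"
  shows "walk Q x (u @ v') y"
  using assms(1)
proof (induction u arbitrary: y)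
  case Nil
  then show ?case using assms(2,3) walk_end_unique by fastforce
next
  case (Cons l u)
  then show ?case
    by (cases l) (auto elim!: walk_ArrE walk_InvE intro!: walk.Arr walk.Inv)
qed

lemma walk_cancel:
  assumes "walk Q x (u @ l @ v) y" "l = [Inv b, Arr b] \<or> l = [Arr b, Inv b]"
  shows "walk Q x (u @ v) y"
proof -
  obtain z where z: "walk Q x (l @ v) z" using walk_suffix[OF assms(1)] by blast
  then have "walk Q x v z"
    using assms(2) by (auto elim!: walk_ArrE walk_InvE)
  then show ?thesis using walk_replace_suffix[OF assms(1) z] by blast
qed

lemma walk_equiv_end:
  "walk_equiv Q x w w' \<Longrightarrow> \<exists>y. walk Q x w y \<and> walk Q x w' y"
proof (induction rule: walk_equiv.induct)
  case (trans w w' w'')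
  then show ?case using walk_end_unique[of Q x w'] by blast
next
  case (cancel_tail u b v y)
  then show ?case using walk_cancel[OF cancel_tail] by blast
next
  case (cancel_head u b v y)
  then show ?case using walk_cancel[OF cancel_head] by blast
qed blast+

lemma walk_equiv_Cons:
  "walk_equiv Q x w w' \<Longrightarrow> walk Q x (l # w) y \<Longrightarrow> walk_equiv Q x (l # w) (l # w')"
proof (induction arbitrary: y rule: walk_equiv.induct)
  case (refl w z)
  then show ?case by (blast intro: walk_equiv.refl)
next
  case (sym w w')
  obtain z where z: "walk Q x w z" "walk Q x w' z" using walk_equiv_end[OF sym.hyps] by blast
  have "walk Q x (l # w) y"
    using walk_replace_suffix[of Q x "[l]" w' y z w] sym.prems z by simp
  then show ?case using sym.IH by (blast intro: walk_equiv.sym)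
next
  case (trans w w' w'')
  obtain z where z: "walk Q x w z" "walk Q x w' z" using walk_equiv_end[OF trans.hyps(1)] by blast
  have "walk Q x (l # w') y"
    using walk_replace_suffix[of Q x "[l]" w y z w'] trans.prems z by simp
  then show ?case using trans.IH trans.prems by (blast intro: walk_equiv.trans)
next
  case (cancel_tail u b v)
  then show ?case using walk_equiv.cancel_tail[of Q x "l # u" b v y] by simp
next
  case (cancel_head u b v)
  then show ?case using walk_equiv.cancel_head[of Q x "l # u" b v y] by simp
qed

lemma equiv_walk_rel: "equiv {w. \<exists>y. walk Q x w y} (walk_rel Q x)"
proof (rule equivI)
  show "walk_rel Q x \<subseteq> {w. \<exists>y. walk Q x w y} \<times> {w. \<exists>y. walk Q x w y}"
    by (auto simp: walk_rel_def dest: walk_equiv_end)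
  show "refl_on {w. \<exists>y. walk Q x w y} (walk_rel Q x)"
    by (auto simp: refl_on_def walk_rel_def intro: walk_equiv.refl)
  show "sym (walk_rel Q x)"
    unfolding sym_def walk_rel_def by (blast intro: walk_equiv.sym)
  show "trans (walk_rel Q x)"
    unfolding trans_def walk_rel_def by (blast intro: walk_equiv.trans)
qed

lemma end_vertex_class:
  assumes "walk Q x w y"
  shows "end_vertex Q x (walk_rel Q x `` {w}) = y"
  unfolding end_vertex_def
proof (rule the_equality)
  show "\<exists>v\<in>walk_rel Q x `` {w}. walk Q x v y"
    using assms by (auto simp: walk_rel_def intro: walk_equiv.refl)
next
  fix z
  assume "\<exists>v\<in>walk_rel Q x `` {w}. walk Q x v z"
  then obtain v where v: "walk_equiv Q x w v" "walk Q x v z" by (auto simp: walk_rel_def)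
  obtain z' where z': "walk Q x w z'" "walk Q x v z'" using walk_equiv_end[OF v(1)] by blast
  show "z = y" using walk_end_unique assms v(2) z' by metis
qed

lemma head_universal_cover:
  assumes "walk Q x w (tail Q b)" "b \<in> arcs Q"
  shows "head (universal_cover Q x) (walk_rel Q x `` {w}, b) = walk_rel Q x `` {Arr b # w}"
proof -
  have "walk_rel Q x `` {Arr b # v} = walk_rel Q x `` {Arr b # w}"
    if "v \<in> walk_rel Q x `` {w}" for v
  proof -
    have "walk_equiv Q x (Arr b # w) (Arr b # v)"
      using that walk_equiv_Cons[of Q x w v "Arr b"] walk.Arr[OF assms]
      by (auto simp: walk_rel_def)
    then show ?thesis
      using equiv_class_eq[OF equiv_walk_rel, of "Arr b # w" "Arr b # v" Q x]
      by (simp add: walk_rel_def)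
  qed
  moreover have "w \<in> walk_rel Q x `` {w}"
    using assms(1) by (auto simp: walk_rel_def intro: walk_equiv.refl)
  ultimately have "(\<Union>v\<in>walk_rel Q x `` {w}. walk_rel Q x `` {Arr b # v}) =
      walk_rel Q x `` {Arr b # w}"
    by blast
  then show ?thesis by (simp add: universal_cover_def)
qed

lemma wf_universal_cover: "wf_digraph (universal_cover Q x)"
proof
  fix e
  assume e: "e \<in> arcs (universal_cover Q x)"
  then show "tail (universal_cover Q x) e \<in> verts (universal_cover Q x)"
    by (auto simp: universal_cover_def)
  obtain w y b where w: "walk Q x w y" "e = (walk_rel Q x `` {w}, b)" "b \<in> arcs Q"
      "end_vertex Q x (walk_rel Q x `` {w}) = tail Q b"
    using e by (auto simp: universal_cover_def elim!: quotientE)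
  then have w': "walk Q x w (tail Q b)" using end_vertex_class[OF w(1)] by simp
  show "head (universal_cover Q x) e \<in> verts (universal_cover Q x)"
    using walk.Arr[OF w' w(3)] unfolding w(2) head_universal_cover[OF w' w(3)]
    by (auto simp: universal_cover_def intro!: quotientI)
qed

end

theory Submission
  imports Defs
begin

text \<open>
  The implications from the equal kernels property to the injectivity of each \<open>N(\<gamma>\<^sub>i)\<close>, and
  from there to \<open>M \<in> Inj\<close>, hold because \<open>N(\<gamma>\<^sub>i)\<close> is the combination whose coefficient vector
  is the \<open>i\<close>-th unit vector, and because \<open>N(\<gamma>\<^sub>i)\<close> restricts to \<open>M(\<delta>)\<close> on the summand at the
  tail of an arrow \<open>\<delta>\<close> above \<open>\<gamma>\<^sub>i\<close> (\<open>inj_on_map_if_inj_on_push_down\<close>).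

  The remaining implication, from \<open>M \<in> Inj\<close> to equal kernels, uses that supports are finite while
  the cover is unbounded in the direction of each arrow.  Fix \<open>i\<close> with \<open>\<alpha>\<^sub>i \<noteq> 0\<close> and give a vertex
  \<open>[w]\<close> of the cover as height the exponent sum of \<open>\<gamma>\<^sub>i\<close> in \<open>w\<close>, which cancellation preserves.
  Arrows above \<open>\<gamma>\<^sub>i\<close> raise the height by one, all other arrows preserve it.  Suppose that
  \<open>f \<noteq> f'\<close> have the same image under the combination \<open>\<Sum>\<^sub>j \<alpha>\<^sub>j N(\<gamma>\<^sub>j)\<close>, and let \<open>y\<close> be a vertex of
  maximal height with \<open>f y \<noteq> f' y\<close>.  Compare the images at the head \<open>z\<close> of the arrow
  \<open>\<delta>\<close> above \<open>\<gamma>\<^sub>i\<close> that starts in \<open>y\<close>.  Every arrow into \<open>z\<close> above another \<open>\<gamma>\<^sub>j\<close> starts at the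
  height of \<open>z\<close>, above \<open>y\<close>, where \<open>f\<close> and \<open>f'\<close> agree.  Hence the contributions of \<open>\<delta>\<close> agree as well:
  \<open>\<alpha>\<^sub>i M(\<delta>)(f y) = \<alpha>\<^sub>i M(\<delta>)(f' y)\<close>, which contradicts the injectivity of \<open>M(\<delta>)\<close>.  The lemma
  \<open>inj_on_push_down_combination\<close> carries this out for a push-down along any map that admits such a
  height, and \<open>cover_height_head\<close> provides the height on a universal cover.
\<close>

section \<open>Injectivity of push-downs\<close>

lemma inj_on_map_if_inj_on_push_down:
  fixes C :: "('c, 'd) pre_digraph" and M :: "('c, 'd, 'k::field, 'v::ab_group_add) quiver_rep"
  assumes d: "d \<in> arcs C" "tail C d \<in> verts C" "pv (tail C d) = i"
    and unique: "\<And>e. e \<in> arcs C \<Longrightarrow> pa e = pa d \<Longrightarrow> tail C e = tail C d \<Longrightarrow> e = d"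
    and zero: "\<And>y. y \<in> verts C \<Longrightarrow> 0 \<in> sp M y"
    and inj: "inj_on (mp (push_down C pv pa M) (pa d)) (sp (push_down C pv pa M) i)"
  shows "inj_on (mp M d) (sp M (tail C d))"
proof (rule inj_onI)
  fix u u' assume u: "u \<in> sp M (tail C d)" "u' \<in> sp M (tail C d)" "mp M d u = mp M d u'"
  define single where "single v = (\<lambda>y. if y = tail C d then v else 0)" for v :: 'v
  have single_in: "single v \<in> sp (push_down C pv pa M) i" if "v \<in> sp M (tail C d)" for v
  proof -
    have "finite {y. single v y \<noteq> 0}"
      by (rule finite_subset[of _ "{tail C d}"]) (auto simp: single_def)
    then show ?thesis
      using that d zero by (auto simp: push_down_def single_def)
  qed
  have "mp M e (single u (tail C e)) = mp M e (single u' (tail C e))"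
    if "e \<in> arcs C" "pa e = pa d" for e
  proof (cases "tail C e = tail C d")
    case True
    then have "e = d" using unique that by blast
    then show ?thesis using u(3) by (simp add: single_def)
  qed (simp add: single_def)
  then have "mp (push_down C pv pa M) (pa d) (single u) = mp (push_down C pv pa M) (pa d) (single u')"
    by (auto simp: push_down_def intro!: sum.cong)
  then have "single u = single u'"
    using inj single_in u(1,2) by (auto dest: inj_onD)
  then show "u = u'"
    by (metis single_def)
qed

text \<open>
  The height \<open>h\<close> singles out the arrow \<open>g\<close>: a difference of two elements cannot be cancelled at the
  head of a \<open>g\<close>-arrow that starts at a highest point of the support of the difference.
\<close>

lemma inj_on_push_down_combination:
  fixes C :: "('c, 'd) pre_digraph" and pv :: "'c \<Rightarrow> 'a" and pa :: "'d \<Rightarrow> 'b"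
    and h :: "'c \<Rightarrow> int" and \<alpha> :: "'b \<Rightarrow> 'k::field"
    and M :: "('c, 'd, 'k, 'v::ab_group_add) quiver_rep"
  defines "N \<equiv> push_down C pv pa M"
  assumes vs: "vector_space (scl M)"
    and L: "finite L" "g \<in> L" "\<alpha> g \<noteq> 0"
    and out: "\<And>y. y \<in> verts C \<Longrightarrow> pv y = i \<Longrightarrow> \<exists>d\<in>arcs C. pa d = g \<and> tail C d = y"
    and unique: "\<And>d e. d \<in> arcs C \<Longrightarrow> e \<in> arcs C \<Longrightarrow> pa d = g \<Longrightarrow> pa e = g
      \<Longrightarrow> head C d = head C e \<Longrightarrow> d = e"
    and height: "\<And>d. d \<in> arcs C \<Longrightarrow> pa d \<in> L
      \<Longrightarrow> h (head C d) = h (tail C d) + (if pa d = g then 1 else 0)"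
    and inj: "\<And>d. d \<in> arcs C \<Longrightarrow> pa d = g \<Longrightarrow> inj_on (mp M d) (sp M (tail C d))"
  shows "inj_on (\<lambda>x. \<Sum>l\<in>L. scl N (\<alpha> l) (mp N l x)) (sp N i)"
proof (rule inj_onI, rule ccontr)
  fix f f'
  assume f: "f \<in> sp N i" "f' \<in> sp N i" and neq: "f \<noteq> f'"
    and eq: "(\<Sum>l\<in>L. scl N (\<alpha> l) (mp N l f)) = (\<Sum>l\<in>L. scl N (\<alpha> l) (mp N l f'))"
  interpret vector_space "scl M" by (rule vs)
  define D where "D = {y. f y \<noteq> f' y}"
  have "D \<subseteq> {y. f y \<noteq> 0} \<union> {y. f' y \<noteq> 0}" by (auto simp: D_def)
  moreover have "finite {y. f y \<noteq> 0}" "finite {y. f' y \<noteq> 0}"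
    using f by (simp_all add: N_def push_down_def)
  ultimately have finD: "finite D" by (meson finite_UnI finite_subset)
  have "D \<noteq> {}" using neq by (auto simp: D_def)
  then have "Max (h ` D) \<in> h ` D" using finD by simp
  then obtain y where y: "y \<in> D" and "h y = Max (h ` D)" by auto
  then have top: "h y' \<le> h y" if "y' \<in> D" for y' using finD that by simp
  have fibre: "if y \<in> verts C \<and> pv y = i then x y \<in> sp M y else x y = 0" if "x \<in> sp N i" for x
    using that by (simp add: N_def push_down_def)
  have y_in: "y \<in> verts C \<and> pv y = i"
  proof (rule ccontr)
    assume "\<not> ?thesis"
    then have "f y = 0" "f' y = 0" using fibre[OF f(1)] fibre[OF f(2)] by (simp_all only: if_False)
    then show False using y by (simp add: D_def)
  qed
  then have fy: "f y \<in> sp M y" "f' y \<in> sp M y"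
    using fibre[OF f(1)] fibre[OF f(2)] by (simp_all only: if_True simp_thms)
  obtain d where d: "d \<in> arcs C" "pa d = g" "tail C d = y" using out y_in by blast
  define z where "z = head C d"
  have hz: "h z = h y + 1" using height[of d] d L(2) by (simp add: z_def)
  have pointwise: "(\<Sum>l\<in>L. scl N (\<alpha> l) (mp N l x)) z = (\<Sum>l\<in>L. scl M (\<alpha> l) (mp N l x z))" for x
    using L(1) by (induction L rule: finite_induct) (simp_all add: N_def push_down_def)
  have others: "mp N l f z = mp N l f' z" if l: "l \<in> L" "l \<noteq> g" for l
  proof -
    have "f (tail C e) = f' (tail C e)" if "e \<in> arcs C" "pa e = l" "head C e = z" for e
      using top[of "tail C e"] height[of e] that l hz by (auto simp: D_def)
    then show ?thesis by (simp add: N_def push_down_def)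
  qed
  have "{e. e \<in> arcs C \<and> pa e = g \<and> head C e = z} = {d}"
    using unique d z_def by blast
  then have at_g: "mp N g x z = mp M d (x y)" for x
    using d by (simp add: N_def push_down_def)
  have "(\<Sum>l\<in>L - {g}. scl M (\<alpha> l) (mp N l f z)) = (\<Sum>l\<in>L - {g}. scl M (\<alpha> l) (mp N l f' z))"
    using others by (intro sum.cong) auto
  moreover have "(\<Sum>l\<in>L. scl M (\<alpha> l) (mp N l f z)) = (\<Sum>l\<in>L. scl M (\<alpha> l) (mp N l f' z))"
    using fun_cong[OF eq, of z] by (simp only: pointwise)
  ultimately have "scl M (\<alpha> g) (mp M d (f y)) = scl M (\<alpha> g) (mp M d (f' y))"
    by (simp add: sum.remove[OF L(1,2)] at_g)
  then have "mp M d (f y) = mp M d (f' y)" using L(3) by simp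
  then have "f y = f' y" using inj[OF d(1,2)] fy d(3) by (auto dest: inj_onD)
  then show False using y by (simp add: D_def)
qed

section \<open>Arrows and heights in a universal cover\<close>

lemma arc_universal_coverE:
  assumes "d \<in> arcs (universal_cover Q x)"
  obtains w b where "d = (walk_rel Q x `` {w}, b)" "walk Q x w (tail Q b)" "b \<in> arcs Q"
    "tail (universal_cover Q x) d = walk_rel Q x `` {w}"
    "head (universal_cover Q x) d = walk_rel Q x `` {Arr b # w}"
proof -
  obtain w y b where w: "walk Q x w y" "d = (walk_rel Q x `` {w}, b)" "b \<in> arcs Q"
      "end_vertex Q x (walk_rel Q x `` {w}) = tail Q b"
    using assms by (auto simp: universal_cover_def elim!: quotientE)
  have w': "walk Q x w (tail Q b)" using w end_vertex_class[OF w(1)] by simp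
  show ?thesis
    using that[OF w(2) w' w(3)] head_universal_cover[OF w' w(3)] w(2)
    by (simp add: universal_cover_def)
qed

lemma walk_rel_class_eq_iff:
  assumes "walk Q x w y" "walk Q x w' y'"
  shows "walk_rel Q x `` {w} = walk_rel Q x `` {w'} \<longleftrightarrow> walk_equiv Q x w w'"
  using eq_equiv_class_iff[OF equiv_walk_rel, of w Q x w'] assms by (auto simp: walk_rel_def)

text \<open>Prepending the inverse letter on both sides cancels \<open>Arr b\<close>.\<close>

lemma walk_equiv_Arr_cancel:
  assumes "walk_equiv Q x (Arr b # w) (Arr b # w')"
    and "walk Q x w (tail Q b)" "walk Q x w' (tail Q b)" "b \<in> arcs Q"
  shows "walk_equiv Q x w w'"
proof -
  have walks: "walk Q x (Inv b # Arr b # v) (tail Q b)" if "walk Q x v (tail Q b)" for v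
    using that assms(4) by (intro walk.Inv walk.Arr)
  have "walk_equiv Q x (Inv b # Arr b # v) v" if "walk Q x v (tail Q b)" for v
    using walk_equiv.cancel_tail[of Q x "[]" b v] walks[OF that] by simp
  moreover have "walk_equiv Q x (Inv b # Arr b # w) (Inv b # Arr b # w')"
    using walk_equiv_Cons[OF assms(1)] walks[OF assms(2)] .
  ultimately show ?thesis
    using assms(2,3) by (blast intro: walk_equiv.sym walk_equiv.trans)
qed

lemma arc_universal_cover_eqI:
  assumes "d \<in> arcs (universal_cover Q x)" "e \<in> arcs (universal_cover Q x)" "snd d = snd e"
    and "head (universal_cover Q x) d = head (universal_cover Q x) e"
  shows "d = e"
proof -
  obtain w b where d: "d = (walk_rel Q x `` {w}, b)" "walk Q x w (tail Q b)" "b \<in> arcs Q"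
      "head (universal_cover Q x) d = walk_rel Q x `` {Arr b # w}"
    using assms(1) by (rule arc_universal_coverE)
  obtain w' b' where e: "e = (walk_rel Q x `` {w'}, b')" "walk Q x w' (tail Q b')" "b' \<in> arcs Q"
      "head (universal_cover Q x) e = walk_rel Q x `` {Arr b' # w'}"
    using assms(2) by (rule arc_universal_coverE)
  have b: "b' = b" using assms(3) d(1) e(1) by simp
  have "walk_equiv Q x (Arr b # w) (Arr b # w')"
    using assms(4) d e walk_rel_class_eq_iff[OF walk.Arr[OF d(2,3)] walk.Arr[OF e(2,3)]]
    by (simp add: b)
  then have "walk_equiv Q x w w'"
    by (rule walk_equiv_Arr_cancel[OF _ d(2) e(2)[unfolded b] d(3)])
  then have "walk_rel Q x `` {w} = walk_rel Q x `` {w'}"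
    by (simp only: walk_rel_class_eq_iff[OF d(2) e(2)])
  then show ?thesis by (simp only: d(1) e(1) b)
qed

fun exponent_sum :: "'b \<Rightarrow> 'b letter list \<Rightarrow> int" where
  "exponent_sum g [] = 0"
| "exponent_sum g (Arr b # w) = exponent_sum g w + (if b = g then 1 else 0)"
| "exponent_sum g (Inv b # w) = exponent_sum g w - (if b = g then 1 else 0)"

lemma exponent_sum_append: "exponent_sum g (u @ v) = exponent_sum g u + exponent_sum g v"
  by (induction g u rule: exponent_sum.induct) simp_all

lemma exponent_sum_walk_equiv: "walk_equiv Q x w w' \<Longrightarrow> exponent_sum g w = exponent_sum g w'"
  by (induction rule: walk_equiv.induct) (simp_all add: exponent_sum_append)

definition cover_height :: "'b \<Rightarrow> 'b letter list set \<Rightarrow> int" where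
  "cover_height g c = exponent_sum g (SOME w. w \<in> c)"

lemma cover_height_class:
  assumes "walk Q x w y"
  shows "cover_height g (walk_rel Q x `` {w}) = exponent_sum g w"
proof -
  have "w \<in> walk_rel Q x `` {w}"
    using assms by (auto simp: walk_rel_def intro: walk_equiv.refl)
  then have "(SOME v. v \<in> walk_rel Q x `` {w}) \<in> walk_rel Q x `` {w}" by (rule someI)
  then have "walk_equiv Q x w (SOME v. v \<in> walk_rel Q x `` {w})" by (simp add: walk_rel_def)
  then show ?thesis
    unfolding cover_height_def by (rule exponent_sum_walk_equiv[symmetric])
qed

lemma cover_height_head:
  assumes "d \<in> arcs (universal_cover Q x)"
  shows "cover_height g (head (universal_cover Q x) d) =
    cover_height g (tail (universal_cover Q x) d) + (if snd d = g then 1 else 0)"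
proof -
  obtain w b where d: "d = (walk_rel Q x `` {w}, b)" "walk Q x w (tail Q b)" "b \<in> arcs Q"
      "tail (universal_cover Q x) d = walk_rel Q x `` {w}"
      "head (universal_cover Q x) d = walk_rel Q x `` {Arr b # w}"
    using assms by (rule arc_universal_coverE)
  show ?thesis
    unfolding d(4,5) cover_height_class[OF d(2)] cover_height_class[OF walk.Arr[OF d(2,3)]]
    by (simp add: d(1))
qed

section \<open>Equal kernels over the Kronecker quiver\<close>

lemma inj_on_map_if_equal_kernels:
  fixes N :: "(nat, nat, 'k::field, 'v::ab_group_add) quiver_rep"
  assumes N: "equal_kernels r N" and i: "i \<in> {1..r}"
    and scale: "\<And>x. scl N 0 x = 0" "\<And>x. scl N 1 x = x"
  shows "inj_on (mp N i) (sp N 1)"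
proof -
  define e :: "nat \<Rightarrow> 'k" where "e = (\<lambda>j. if j = i then 1 else 0)"
  have "(\<lambda>x. \<Sum>j\<in>{1..r}. scl N (e j) (mp N j x)) = mp N i"
  proof
    fix x
    have "(\<Sum>j\<in>{1..r}. scl N (e j) (mp N j x)) = (\<Sum>j\<in>{1..r}. if j = i then mp N j x else 0)"
      by (intro sum.cong) (auto simp: e_def scale)
    also have "\<dots> = mp N i x" using i by simp
    finally show "(\<Sum>j\<in>{1..r}. scl N (e j) (mp N j x)) = mp N i x" .
  qed
  moreover have "\<exists>j\<in>{1..r}. e j \<noteq> 0"
    using i by (intro bexI[of _ i]) (simp_all add: e_def)
  then have "inj_on (\<lambda>x. \<Sum>j\<in>{1..r}. scl N (e j) (mp N j x)) (sp N 1)"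
    by (rule N[unfolded equal_kernels_def, rule_format])
  ultimately show ?thesis by (simp only:)
qed

theorem theorem3p1:
  fixes r :: nat
    and M :: "(nat letter list set, nat letter list set \<times> nat,
               'k::alg_closed_field, 'v::ab_group_add) quiver_rep"
  assumes "r \<ge> 3"
    and "M \<in> rep (\<C> r)"
    and "indecomposable (\<C> r) M"
  shows "(equal_kernels r (\<pi>\<^sub>\<lambda> r M) \<longleftrightarrow>
            (\<forall>i\<in>{1..r}. inj_on (mp (\<pi>\<^sub>\<lambda> r M) i) (sp (\<pi>\<^sub>\<lambda> r M) 1))) \<and>
         ((\<forall>i\<in>{1..r}. inj_on (mp (\<pi>\<^sub>\<lambda> r M) i) (sp (\<pi>\<^sub>\<lambda> r M) 1)) \<longleftrightarrow>
            M \<in> Inj (\<C> r))"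
proof -
  let ?N = "\<pi>\<^sub>\<lambda> r M" and ?pv = "end_vertex (\<Gamma> r) 1"
  have vs: "vector_space (scl M)" using assms(2) by (simp add: rep_def)
  interpret vector_space "scl M" by (rule vs)
  have scale: "scl ?N 0 f = 0" "scl ?N 1 f = f" for f
    by (auto simp: push_down_Kronecker_def push_down_def)
  have zero: "0 \<in> sp M y" if "y \<in> verts (\<C> r)" for y
    using assms(2) that subspace_0 by (auto simp: rep_def)
  have tails: "tail (\<C> r) d \<in> verts (\<C> r) \<and> ?pv (tail (\<C> r) d) = 1 \<and> snd d \<in> {1..r}"
    if "d \<in> arcs (\<C> r)" for d
    using that by (auto simp: Kronecker_cover_def universal_cover_def Kronecker_quiver_def)
  have out: "\<exists>d\<in>arcs (\<C> r). snd d = i \<and> tail (\<C> r) d = y"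
    if "i \<in> {1..r}" "y \<in> verts (\<C> r)" "?pv y = 1" for i y
    using that by (auto simp: Kronecker_cover_def universal_cover_def Kronecker_quiver_def)

  have "inj_on (mp ?N i) (sp ?N 1)" if "equal_kernels r ?N" "i \<in> {1..r}" for i
    using inj_on_map_if_equal_kernels[OF that] scale by blast
  moreover have "M \<in> Inj (\<C> r)" if N: "\<forall>i\<in>{1..r}. inj_on (mp ?N i) (sp ?N 1)"
  proof -
    have "inj_on (mp M d) (sp M (tail (\<C> r) d))" if d: "d \<in> arcs (\<C> r)" for d
    proof (rule inj_on_map_if_inj_on_push_down[where pa = snd and pv = ?pv and i = 1, OF d])
      show "inj_on (mp (push_down (\<C> r) ?pv snd M) (snd d)) (sp (push_down (\<C> r) ?pv snd M) 1)"
        using N tails[OF d] by (simp add: push_down_Kronecker_def)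
      show "e = d" if "snd e = snd d" "tail (\<C> r) e = tail (\<C> r) d" for e
        using that by (simp add: Kronecker_cover_def universal_cover_def prod_eq_iff)
    qed (use tails[OF d] zero in auto)
    then show ?thesis using assms(2) by (simp add: Inj_def)
  qed
  moreover have "equal_kernels r ?N" if M: "M \<in> Inj (\<C> r)"
    unfolding equal_kernels_def push_down_Kronecker_def
  proof (intro allI impI, elim bexE)
    fix \<alpha> :: "nat \<Rightarrow> 'k" and g
    assume g: "g \<in> {1..r}" "\<alpha> g \<noteq> 0"
    let ?P = "push_down (\<C> r) ?pv snd M"
    show "inj_on (\<lambda>x. \<Sum>i\<in>{1..r}. scl ?P (\<alpha> i) (mp ?P i x)) (sp ?P 1)"
    proof (rule inj_on_push_down_combination[where h = "cover_height g" and g = g])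
      show "d = e" if "d \<in> arcs (\<C> r)" "e \<in> arcs (\<C> r)" "snd d = g" "snd e = g"
        "head (\<C> r) d = head (\<C> r) e" for d e
        using arc_universal_cover_eqI that unfolding Kronecker_cover_def by metis
      show "cover_height g (head (\<C> r) d) =
          cover_height g (tail (\<C> r) d) + (if snd d = g then 1 else 0)"
        if "d \<in> arcs (\<C> r)" for d
        using cover_height_head that unfolding Kronecker_cover_def by metis
    qed (use vs g out M in \<open>auto simp: Inj_def\<close>)
  qed
  ultimately show ?thesis by blast
qed

end
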